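(* Let $\sigma$, $\tau$, and $\rho$ be three (possibly empty) permutations. Then every permutation avoiding $\sigma\oplus(\tau\ominus 1)\oplus\rho$ is a merge of a permutation avoiding $\sigma\oplus(\tau\ominus 1)$ and a permutation avoiding $(\tau\ominus 1)\oplus\rho$.
   Context: For a permutation $\pi$ of $\{1,\dots,n\}$ and a set $I=\{i_1<\cdots<i_k\}\subseteq\{1,\dots,n\}$, let $\pi[I]$ denote the permutation of $\{1,\dots,k\}$ order-isomorphic to the sequence $\pi(i_1)\cdots\pi(i_k)$. The permutation $\pi$ contains a permutation $\sigma$ if $\pi[I]=\sigma$ for some $I$; otherwise $\pi$ avoids $\sigma$. A permutation $\pi$ of length $n$ is a merge of permutations $\alpha$ of length $k$ and $\beta$ of length $n-k$ (where $0\le k\le n$, so $\alpha$ or $\beta$ may be empty) if there are disjoint sets $I,J$ with $I\cup J=\{1,\dots,n\}$, $\pi[I]=\alpha$ and $\pi[J]=\beta$. For permutations $\sigma$ of length $k$ and $\tau$ of length $\ell$, the direct sum $\sigma\oplus\tau$ and the skew sum $\sigma\ominus\tau$ are the permutations of length $k+\ell$ given by $(\sigma\oplus\tau)(i)=\sigma(i)$ for $i\le k$ and $(\sigma\oplus\tau)(i)=\tau(i-k)+k$ for $i>k$; and $(\sigma\ominus\tau)(i)=\sigma(i)+\ell$ for $i\le k$ and $(\sigma\ominus\tau)(i)=\tau(i-k)$ for $i>k$. The symbol $1$ denotes the unique permutation of length $1$. *)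

theory Defs
  imports "HOL-Combinatorics.Multiset_Permutations"
begin

text \<open>
  A permutation of \<open>{1, \<dots>, n}\<close> is its one-line notation \<open>[\<pi>(1), \<dots>, \<pi>(n)]\<close>.
  Values range over \<open>{1, \<dots>, n}\<close>, but positions are those of the list, i.e. \<open>{0, \<dots>, n - 1}\<close>,
  so \<open>\<pi>(i)\<close> is \<open>\<pi> ! (i - 1)\<close>.
\<close>

definition is_perm :: "nat list \<Rightarrow> bool" where
  "is_perm \<pi> \<longleftrightarrow> \<pi> \<in> permutations_of_set {1..length \<pi>}"

definition order_isomorphic :: "nat list \<Rightarrow> nat list \<Rightarrow> bool" where
  "order_isomorphic xs ys \<longleftrightarrow> length xs = length ys \<and>
     (\<forall>i<length xs. \<forall>j<length xs. xs ! i < xs ! j \<longleftrightarrow> ys ! i < ys ! j)"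

text \<open>\<open>pattern \<pi> I\<close> is \<open>\<pi>[I]\<close>; it is well defined by \<open>pattern_ex1\<close> below.\<close>

definition pattern :: "nat list \<Rightarrow> nat set \<Rightarrow> nat list" where
  "pattern \<pi> I = (THE \<sigma>. is_perm \<sigma> \<and> order_isomorphic \<sigma> (nths \<pi> I))"

definition contains :: "nat list \<Rightarrow> nat list \<Rightarrow> bool" where
  "contains \<pi> \<sigma> \<longleftrightarrow> (\<exists>I\<subseteq>{..<length \<pi>}. pattern \<pi> I = \<sigma>)"

abbreviation avoids :: "nat list \<Rightarrow> nat list \<Rightarrow> bool" where
  "avoids \<pi> \<sigma> \<equiv> \<not> contains \<pi> \<sigma>"

definition is_merge :: "nat list \<Rightarrow> nat list \<Rightarrow> nat list \<Rightarrow> bool" where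
  "is_merge \<pi> \<alpha> \<beta> \<longleftrightarrow> (\<exists>I J. I \<inter> J = {} \<and> I \<union> J = {..<length \<pi>} \<and>
     pattern \<pi> I = \<alpha> \<and> pattern \<pi> J = \<beta>)"

definition direct_sum :: "nat list \<Rightarrow> nat list \<Rightarrow> nat list"  (infixr \<open>\<oplus>\<close> 65) where
  "\<sigma> \<oplus> \<tau> = \<sigma> @ map (\<lambda>x. x + length \<sigma>) \<tau>"

definition skew_sum :: "nat list \<Rightarrow> nat list \<Rightarrow> nat list"  (infixr \<open>\<ominus>\<close> 65) where
  "\<sigma> \<ominus> \<tau> = map (\<lambda>x. x + length \<tau>) \<sigma> @ \<tau>"

lemma is_perm_iff: "is_perm \<pi> \<longleftrightarrow> distinct \<pi> \<and> set \<pi> = {1..length \<pi>}"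
  by (auto simp: is_perm_def permutations_of_set_def)

lemma direct_sum_assoc: "(\<sigma> \<oplus> \<tau>) \<oplus> \<rho> = \<sigma> \<oplus> (\<tau> \<oplus> \<rho>)"
  by (simp add: direct_sum_def algebra_simps)

lemma is_perm_direct_sum:
  assumes "is_perm \<sigma>" "is_perm \<tau>"
  shows "is_perm (\<sigma> \<oplus> \<tau>)"
proof -
  have "(\<lambda>x. x + length \<sigma>) ` {1..length \<tau>} = {length \<sigma> + 1..length \<sigma> + length \<tau>}"
    by (simp add: add.commute)
  then show ?thesis
    using assms by (auto simp: is_perm_iff direct_sum_def distinct_map inj_on_def)
qed

lemma is_perm_skew_sum:
  assumes "is_perm \<sigma>" "is_perm \<tau>"
  shows "is_perm (\<sigma> \<ominus> \<tau>)"
proof -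
  have "(\<lambda>x. x + length \<tau>) ` {1..length \<sigma>} = {length \<tau> + 1..length \<tau> + length \<sigma>}"
    by (simp add: add.commute)
  then show ?thesis
    using assms by (auto simp: is_perm_iff skew_sum_def distinct_map inj_on_def)
qed

lemma is_perm_singleton: "is_perm [1]"
  by (simp add: is_perm_iff)

lemma order_isomorphic_rank:
  assumes "is_perm \<sigma>" "order_isomorphic \<sigma> xs" "i < length xs"
  shows "\<sigma> ! i = card {j. j < length xs \<and> xs ! j \<le> xs ! i}"
proof -
  have len: "length \<sigma> = length xs"
    and iso: "\<And>i j. i < length xs \<Longrightarrow> j < length xs \<Longrightarrow> \<sigma> ! i < \<sigma> ! j \<longleftrightarrow> xs ! i < xs ! j"
    using assms(2) by (auto simp: order_isomorphic_def)
  have dist: "distinct \<sigma>" and set: "set \<sigma> = {1..length xs}"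
    using assms(1) len by (auto simp: is_perm_iff)
  have "\<sigma> ! i \<in> set \<sigma>"
    using assms(3) len by simp
  then have "\<sigma> ! i \<le> length xs"
    using set by simp
  then have "{1..\<sigma> ! i} = {y \<in> set \<sigma>. y \<le> \<sigma> ! i}"
    using set by auto
  also have "\<dots> = (!) \<sigma> ` {j. j < length xs \<and> \<sigma> ! j \<le> \<sigma> ! i}"
    using len by (auto simp: in_set_conv_nth)
  also have "{j. j < length xs \<and> \<sigma> ! j \<le> \<sigma> ! i} = {j. j < length xs \<and> xs ! j \<le> xs ! i}"
    using iso assms(3) by (auto simp: not_less[symmetric])
  finally have "card {1..\<sigma> ! i} = card ((!) \<sigma> ` {j. j < length xs \<and> xs ! j \<le> xs ! i})"
    by simp
  also have "\<dots> = card {j. j < length xs \<and> xs ! j \<le> xs ! i}"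
    using dist len by (intro card_image) (auto simp: inj_on_def nth_eq_iff_index_eq)
  finally show ?thesis
    by simp
qed

lemma ex1_perm_order_isomorphic:
  assumes "distinct xs"
  shows "\<exists>!\<sigma>. is_perm \<sigma> \<and> order_isomorphic \<sigma> xs"
proof (rule ex_ex1I)
  define S where "S i = {j. j < length xs \<and> xs ! j \<le> xs ! i}" for i
  define \<sigma> where "\<sigma> = map (\<lambda>i. card (S i)) [0..<length xs]"
  have fin: "finite (S i)" for i
    by (simp add: S_def)
  have mono: "card (S i) < card (S j)"
    if "i < length xs" "j < length xs" "xs ! i < xs ! j" for i j
  proof (rule psubset_card_mono[OF fin])
    have "S i \<subseteq> S j"
      using that(3) unfolding S_def by (blast intro: order_trans less_imp_le)
    moreover have "j \<in> S j" "j \<notin> S i"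
      using that by (simp_all add: S_def)
    ultimately show "S i \<subset> S j"
      by blast
  qed
  have iso: "card (S i) < card (S j) \<longleftrightarrow> xs ! i < xs ! j"
    if "i < length xs" "j < length xs" for i j
  proof
    assume "card (S i) < card (S j)"
    moreover have "S j \<subseteq> S i" if "xs ! j \<le> xs ! i"
      using that unfolding S_def by (blast intro: order_trans)
    ultimately show "xs ! i < xs ! j"
      using card_mono[OF fin] by (meson leD leI)
  qed (use mono that in blast)
  have "order_isomorphic \<sigma> xs"
    using iso by (simp add: order_isomorphic_def \<sigma>_def)
  moreover have "is_perm \<sigma>"
  proof -
    have inj: "inj_on (\<lambda>i. card (S i)) {0..<length xs}"
    proof (rule inj_onI)
      fix i j assume *: "i \<in> {0..<length xs}" "j \<in> {0..<length xs}" "card (S i) = card (S j)"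
      then have "xs ! i = xs ! j"
        using mono[of i j] mono[of j i] by (cases "xs ! i" "xs ! j" rule: linorder_cases) auto
      then show "i = j"
        using * assms by (simp add: nth_eq_iff_index_eq)
    qed
    then have dist: "distinct \<sigma>"
      by (simp add: \<sigma>_def distinct_map)
    have "set \<sigma> \<subseteq> {1..length xs}"
    proof
      fix y assume "y \<in> set \<sigma>"
      then obtain i where i: "i < length xs" "y = card (S i)"
        by (auto simp: \<sigma>_def)
      have "i \<in> S i" "S i \<subseteq> {..<length xs}"
        using i by (auto simp: S_def)
      then have "card (S i) > 0" "card (S i) \<le> length xs"
        using fin card_gt_0_iff card_mono[of "{..<length xs}" "S i"] by auto
      then show "y \<in> {1..length xs}"
        using i by simp
    qed
    moreover have "card (set \<sigma>) = length xs"
      using distinct_card[OF dist] by (simp add: \<sigma>_def)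
    ultimately have "set \<sigma> = {1..length xs}"
      by (intro card_subset_eq) auto
    then show ?thesis
      using dist by (simp add: is_perm_iff \<sigma>_def)
  qed
  ultimately show "\<exists>\<sigma>. is_perm \<sigma> \<and> order_isomorphic \<sigma> xs"
    by blast
next
  fix \<sigma> \<tau>
  assume \<sigma>: "is_perm \<sigma> \<and> order_isomorphic \<sigma> xs"
    and \<tau>: "is_perm \<tau> \<and> order_isomorphic \<tau> xs"
  then have len: "length \<sigma> = length xs" "length \<tau> = length xs"
    by (simp_all add: order_isomorphic_def)
  show "\<sigma> = \<tau>"
  proof (rule nth_equalityI)
    fix i assume "i < length \<sigma>"
    then show "\<sigma> ! i = \<tau> ! i"
      using order_isomorphic_rank[of \<sigma> xs i] order_isomorphic_rank[of \<tau> xs i] \<sigma> \<tau> len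
      by metis
  qed (use len in simp)
qed

lemma pattern_ex1:
  assumes "is_perm \<pi>"
  shows "\<exists>!\<sigma>. is_perm \<sigma> \<and> order_isomorphic \<sigma> (nths \<pi> I)"
  using assms by (intro ex1_perm_order_isomorphic distinct_nthsI) (simp add: is_perm_iff)

lemma pattern_eq_iff:
  assumes "is_perm \<pi>"
  shows "pattern \<pi> I = \<sigma> \<longleftrightarrow> is_perm \<sigma> \<and> order_isomorphic \<sigma> (nths \<pi> I)"
proof
  assume "pattern \<pi> I = \<sigma>"
  then show "is_perm \<sigma> \<and> order_isomorphic \<sigma> (nths \<pi> I)"
    using theI'[OF pattern_ex1[OF assms, of I]] by (simp add: pattern_def)
next
  assume "is_perm \<sigma> \<and> order_isomorphic \<sigma> (nths \<pi> I)"
  then show "pattern \<pi> I = \<sigma>"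
    unfolding pattern_def by (rule the1_equality[OF pattern_ex1[OF assms]])
qed

end

theory Submission
  imports Defs
begin

text \<open>
  Colour the entries of \<open>\<pi>\<close> red or blue from left to right, as greedily red as possible: an entry
  becomes blue only if there is an earlier smaller blue entry, or if colouring it red would complete
  a red copy of \<open>\<sigma> \<oplus> (\<tau> \<ominus> 1)\<close>.  The red entries then avoid \<open>\<sigma> \<oplus> (\<tau> \<ominus> 1)\<close> by construction, no red
  entry lies above and to the right of a blue one, and following the first reason for being blue
  backwards, below and to the left of every blue entry \<open>b\<close> (or at \<open>b\<close> itself) there is an entry
  \<open>c\<close> which is the last one of a copy \<open>s t c\<close> of \<open>\<sigma> \<oplus> (\<tau> \<ominus> 1)\<close> whose other entries are red
  (\<open>greedy_colouring\<close>).

  Suppose that \<open>t' b r\<close> is a blue copy of \<open>(\<tau> \<ominus> 1) \<oplus> \<rho>\<close>, and take \<open>s t c\<close> for this \<open>b\<close>.  If \<open>t\<close> lies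
  below \<open>r\<close>, then \<open>s t c r\<close> is a copy of \<open>\<sigma> \<oplus> (\<tau> \<ominus> 1) \<oplus> \<rho>\<close>.  Otherwise some red entry of \<open>t\<close> lies
  above an entry of \<open>r\<close>, hence above all of the blue \<open>t'\<close>, and so it is to the left of all of \<open>t'\<close>.
  Then \<open>s\<close> is to the left of \<open>t'\<close>, and it is below \<open>c\<close>, thus below \<open>b\<close>, so \<open>s t' b r\<close> is a copy of
  \<open>\<sigma> \<oplus> (\<tau> \<ominus> 1) \<oplus> \<rho>\<close> (\<open>occurrence_from_colouring\<close>).  In both cases \<open>\<pi>\<close> does not avoid the pattern.
\<close>

section \<open>Occurrences as lists of positions\<close>

text \<open>
  Listing the positions of a copy in increasing order makes direct and skew sums correspond to
  concatenation of occurrences.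
\<close>

definition occurrence :: "nat list \<Rightarrow> nat list \<Rightarrow> nat list \<Rightarrow> bool" where
  "occurrence \<pi> \<sigma> ps \<longleftrightarrow> sorted_wrt (<) ps \<and> set ps \<subseteq> {..<length \<pi>} \<and>
     order_isomorphic \<sigma> (map ((!) \<pi>) ps)"

lemma nths_conv_map_filter: "nths xs I = map ((!) xs) (filter (\<lambda>i. i \<in> I) [0..<length xs])"
proof (induction xs rule: rev_induct)
  case (snoc x xs)
  have "map ((!) (xs @ [x])) (filter (\<lambda>i. i \<in> I) [0..<length xs]) =
      map ((!) xs) (filter (\<lambda>i. i \<in> I) [0..<length xs])"
    by (auto simp: nth_append)
  with snoc show ?case
    by (auto simp: nths_append)
qed simp

lemma nths_set_sorted:
  assumes "sorted_wrt (<) ps" "set ps \<subseteq> {..<length xs}"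
  shows "nths xs (set ps) = map ((!) xs) ps"
proof -
  have "filter (\<lambda>i. i \<in> set ps) [0..<length xs] = ps"
    using assms by (intro sorted_distinct_set_unique) (auto simp: strict_sorted_iff sorted_wrt_filter)
  then show ?thesis
    by (simp add: nths_conv_map_filter)
qed

lemma order_isomorphic_nth_cong:
  assumes "order_isomorphic xs ys" "set qs \<subseteq> {..<length xs}"
    and "order_isomorphic \<sigma> (map ((!) xs) qs)"
  shows "order_isomorphic \<sigma> (map ((!) ys) qs)"
  using assms by (auto simp: order_isomorphic_def subset_iff)

lemma contains_if_occurrence:
  assumes "is_perm \<pi>" "is_perm \<sigma>" "occurrence \<pi> \<sigma> ps"
  shows "contains \<pi> \<sigma>"
  using assms nths_set_sorted[of ps \<pi>]
  by (auto simp: contains_def occurrence_def pattern_eq_iff intro!: exI[of _ "set ps"])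

lemma occurrence_if_contains:
  assumes "is_perm \<pi>" "contains \<pi> \<sigma>"
  obtains ps where "occurrence \<pi> \<sigma> ps"
proof -
  from assms obtain I where "order_isomorphic \<sigma> (nths \<pi> I)"
    by (auto simp: contains_def pattern_eq_iff)
  then have "occurrence \<pi> \<sigma> (filter (\<lambda>i. i \<in> I) [0..<length \<pi>])"
    by (auto simp: occurrence_def nths_conv_map_filter sorted_wrt_filter)
  then show thesis
    by (rule that)
qed

text \<open>
  Avoidance is needed for the patterns of the two colour classes, whose entries are renumbered;
  composing with the increasing list of the positions in \<open>S\<close> moves a copy back into \<open>\<pi>\<close>, so that
  all further arguments take place in \<open>\<pi>\<close> alone.
\<close>

lemma occurrence_if_pattern_contains:
  assumes "is_perm \<pi>" "contains (pattern \<pi> S) \<sigma>"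
  obtains ps where "occurrence \<pi> \<sigma> ps" "set ps \<subseteq> S"
proof -
  define js where "js = filter (\<lambda>i. i \<in> S) [0..<length \<pi>]"
  have sorted_js: "sorted_wrt (<) js" and set_js: "set js = S \<inter> {..<length \<pi>}"
    by (auto simp: js_def sorted_wrt_filter)
  have \<alpha>: "is_perm (pattern \<pi> S)" and iso: "order_isomorphic (pattern \<pi> S) (map ((!) \<pi>) js)"
    using pattern_eq_iff[OF assms(1), of S "pattern \<pi> S"]
    by (simp_all add: js_def flip: nths_conv_map_filter)
  obtain qs where "occurrence (pattern \<pi> S) \<sigma> qs"
    by (rule occurrence_if_contains[OF \<alpha> assms(2)])
  then have qs: "sorted_wrt (<) qs" "set qs \<subseteq> {..<length (pattern \<pi> S)}"
      "order_isomorphic \<sigma> (map ((!) (pattern \<pi> S)) qs)"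
    by (simp_all add: occurrence_def)
  have qs_less: "set qs \<subseteq> {..<length js}"
    using qs(2) iso by (simp add: order_isomorphic_def)
  then have "set (map ((!) js) qs) \<subseteq> set js"
    by auto
  moreover have "sorted_wrt (<) (map ((!) js) qs)"
    unfolding sorted_wrt_map
    by (rule sorted_wrt_mono_rel[OF _ qs(1)]) (use qs_less sorted_js sorted_wrt_nth_less in blast)
  moreover have "map ((!) (map ((!) \<pi>) js)) qs = map ((!) \<pi>) (map ((!) js) qs)"
    using qs_less by auto
  then have "order_isomorphic \<sigma> (map ((!) \<pi>) (map ((!) js) qs))"
    using order_isomorphic_nth_cong[OF iso qs(2,3)] by metis
  ultimately have "occurrence \<pi> \<sigma> (map ((!) js) qs)" "set (map ((!) js) qs) \<subseteq> S"
    using set_js unfolding occurrence_def by blast+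
  then show thesis
    by (rule that)
qed

section \<open>Occurrences of sums\<close>

lemma is_perm_nth_bounds:
  assumes "is_perm \<sigma>" "i < length \<sigma>"
  shows "0 < \<sigma> ! i" "\<sigma> ! i \<le> length \<sigma>"
  using assms nth_mem[of i \<sigma>] by (auto simp: is_perm_iff)

lemma order_isomorphic_append_iff:
  assumes "length xs = length us" "length ys = length vs"
  shows "order_isomorphic (xs @ ys) (us @ vs) \<longleftrightarrow>
    order_isomorphic xs us \<and> order_isomorphic ys vs \<and>
    (\<forall>i<length xs. \<forall>j<length ys. (xs ! i < ys ! j \<longleftrightarrow> us ! i < vs ! j) \<and>
       (ys ! j < xs ! i \<longleftrightarrow> vs ! j < us ! i))"
  (is "?L \<longleftrightarrow> ?R")
proof
  assume L: ?L
  have *: "(xs @ ys) ! i < (xs @ ys) ! j \<longleftrightarrow> (us @ vs) ! i < (us @ vs) ! j"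
    if "i < length xs + length ys" "j < length xs + length ys" for i j
    using L that by (auto simp: order_isomorphic_def)
  have "xs ! i < xs ! j \<longleftrightarrow> us ! i < us ! j" if "i < length xs" "j < length xs" for i j
    using *[of i j] that assms by (simp add: nth_append)
  moreover have "ys ! i < ys ! j \<longleftrightarrow> vs ! i < vs ! j" if "i < length ys" "j < length ys" for i j
    using *[of "length xs + i" "length xs + j"] that assms by (simp add: nth_append)
  moreover have "(xs ! i < ys ! j \<longleftrightarrow> us ! i < vs ! j) \<and> (ys ! j < xs ! i \<longleftrightarrow> vs ! j < us ! i)"
    if "i < length xs" "j < length ys" for i j
    using *[of i "length xs + j"] *[of "length xs + j" i] that assms by (simp add: nth_append)
  ultimately show ?R
    using assms by (simp add: order_isomorphic_def)
next
  assume ?R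
  then show ?L
    using assms by (auto simp: order_isomorphic_def nth_append)
qed

lemma order_isomorphic_map_add:
  "order_isomorphic (map (\<lambda>x. x + k) \<sigma>) us \<longleftrightarrow> order_isomorphic \<sigma> us"
  by (auto simp: order_isomorphic_def)

text \<open>
  Being permutations, the summands have values between \<open>1\<close> and their length, so the shift in a sum
  separates the two blocks of values completely.
\<close>

lemma order_isomorphic_direct_sum_iff:
  assumes "is_perm \<sigma>" "is_perm \<tau>" "length \<sigma> = length us" "length \<tau> = length vs"
  shows "order_isomorphic (\<sigma> \<oplus> \<tau>) (us @ vs) \<longleftrightarrow>
    order_isomorphic \<sigma> us \<and> order_isomorphic \<tau> vs \<and> (\<forall>u\<in>set us. \<forall>v\<in>set vs. u < v)"
proof -
  have "\<not> \<tau> ! j + length us < \<sigma> ! i \<and> \<sigma> ! i < \<tau> ! j + length us"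
    if "i < length us" "j < length vs" for i j
    using is_perm_nth_bounds[OF assms(1), of i] is_perm_nth_bounds[OF assms(2), of j] that assms(3,4)
    by simp
  moreover have "(u < v \<and> \<not> v < u) \<longleftrightarrow> u < v" for u v :: nat
    by auto
  ultimately show ?thesis
    using assms(3,4)
    by (simp add: direct_sum_def order_isomorphic_append_iff order_isomorphic_map_add
        all_set_conv_all_nth cong: imp_cong)
qed

lemma order_isomorphic_skew_sum_iff:
  assumes "is_perm \<sigma>" "is_perm \<tau>" "length \<sigma> = length us" "length \<tau> = length vs"
  shows "order_isomorphic (\<sigma> \<ominus> \<tau>) (us @ vs) \<longleftrightarrow>
    order_isomorphic \<sigma> us \<and> order_isomorphic \<tau> vs \<and> (\<forall>u\<in>set us. \<forall>v\<in>set vs. v < u)"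
proof -
  have "\<tau> ! j < \<sigma> ! i + length vs \<and> \<not> \<sigma> ! i + length vs < \<tau> ! j"
    if "i < length us" "j < length vs" for i j
    using is_perm_nth_bounds[OF assms(1), of i] is_perm_nth_bounds[OF assms(2), of j] that assms(3,4)
    by simp
  moreover have "(\<not> v < u \<and> u < v) \<longleftrightarrow> u < v" for u v :: nat
    by auto
  ultimately show ?thesis
    using assms(3,4)
    by (simp add: skew_sum_def order_isomorphic_append_iff order_isomorphic_map_add
        all_set_conv_all_nth cong: imp_cong)
qed

lemma length_occurrence: "occurrence \<pi> \<sigma> ps \<Longrightarrow> length ps = length \<sigma>"
  by (simp add: occurrence_def order_isomorphic_def)

lemma occurrence_direct_sum_append_iff:
  assumes "is_perm \<sigma>" "is_perm \<tau>" "length ps = length \<sigma>" "length qs = length \<tau>"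
  shows "occurrence \<pi> (\<sigma> \<oplus> \<tau>) (ps @ qs) \<longleftrightarrow> occurrence \<pi> \<sigma> ps \<and> occurrence \<pi> \<tau> qs \<and>
    (\<forall>p\<in>set ps. \<forall>q\<in>set qs. p < q \<and> \<pi> ! p < \<pi> ! q)"
  using assms by (auto simp: occurrence_def sorted_wrt_append order_isomorphic_direct_sum_iff)

lemma occurrence_skew_sum_append_iff:
  assumes "is_perm \<sigma>" "is_perm \<tau>" "length ps = length \<sigma>" "length qs = length \<tau>"
  shows "occurrence \<pi> (\<sigma> \<ominus> \<tau>) (ps @ qs) \<longleftrightarrow> occurrence \<pi> \<sigma> ps \<and> occurrence \<pi> \<tau> qs \<and>
    (\<forall>p\<in>set ps. \<forall>q\<in>set qs. p < q \<and> \<pi> ! q < \<pi> ! p)"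
  using assms by (auto simp: occurrence_def sorted_wrt_append order_isomorphic_skew_sum_iff)

lemma occurrence_direct_sumE:
  assumes "occurrence \<pi> (\<sigma> \<oplus> \<tau>) ps" "is_perm \<sigma>" "is_perm \<tau>"
  obtains qs rs where "ps = qs @ rs" "occurrence \<pi> \<sigma> qs" "occurrence \<pi> \<tau> rs"
    "\<And>q r. q \<in> set qs \<Longrightarrow> r \<in> set rs \<Longrightarrow> q < r \<and> \<pi> ! q < \<pi> ! r"
proof -
  have "length ps = length \<sigma> + length \<tau>"
    using length_occurrence[OF assms(1)] by (simp add: direct_sum_def)
  then show thesis
    using that[of "take (length \<sigma>) ps" "drop (length \<sigma>) ps"] assms
      occurrence_direct_sum_append_iff[of \<sigma> \<tau> "take (length \<sigma>) ps" "drop (length \<sigma>) ps" \<pi>]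
    by simp
qed

lemma occurrence_skew_sumE:
  assumes "occurrence \<pi> (\<sigma> \<ominus> \<tau>) ps" "is_perm \<sigma>" "is_perm \<tau>"
  obtains qs rs where "ps = qs @ rs" "occurrence \<pi> \<sigma> qs" "occurrence \<pi> \<tau> rs"
    "\<And>q r. q \<in> set qs \<Longrightarrow> r \<in> set rs \<Longrightarrow> q < r \<and> \<pi> ! r < \<pi> ! q"
proof -
  have "length ps = length \<sigma> + length \<tau>"
    using length_occurrence[OF assms(1)] by (simp add: skew_sum_def)
  then show thesis
    using that[of "take (length \<sigma>) ps" "drop (length \<sigma>) ps"] assms
      occurrence_skew_sum_append_iff[of \<sigma> \<tau> "take (length \<sigma>) ps" "drop (length \<sigma>) ps" \<pi>]
    by simp
qed

lemma occurrence_skew_sum_oneE: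
  assumes "occurrence \<pi> (\<tau> \<ominus> [1]) ps" "is_perm \<tau>"
  obtains qs r where "ps = qs @ [r]" "occurrence \<pi> \<tau> qs" "occurrence \<pi> [1] [r]"
    "\<And>q. q \<in> set qs \<Longrightarrow> q < r \<and> \<pi> ! r < \<pi> ! q"
proof -
  obtain qs rs where *: "ps = qs @ rs" "occurrence \<pi> \<tau> qs" "occurrence \<pi> [1] rs"
    "\<And>q r. q \<in> set qs \<Longrightarrow> r \<in> set rs \<Longrightarrow> q < r \<and> \<pi> ! r < \<pi> ! q"
    using occurrence_skew_sumE[OF assms is_perm_singleton] by metis
  obtain r where "rs = [r]"
    using length_occurrence[OF *(3)] by (auto simp: length_Suc_conv)
  with * that show thesis
    by simp
qed

section \<open>The greedy colouring\<close>

text \<open>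
  \<open>R\<close> is the set of red positions among the first \<open>n\<close>.  The last property is what remains of the
  reason for which a position became blue once chains of smaller earlier blue entries have been
  followed to their start; in this form it survives adding further positions.
\<close>

lemma greedy_colouring:
  assumes "\<mu> \<noteq> []"
  shows "\<exists>R\<subseteq>{..<n}. (\<forall>ps. occurrence \<pi> \<mu> ps \<longrightarrow> \<not> set ps \<subseteq> R) \<and>
    (\<forall>r\<in>R. \<forall>b<r. b \<notin> R \<longrightarrow> \<not> \<pi> ! b < \<pi> ! r) \<and>
    (\<forall>b<n. b \<notin> R \<longrightarrow> (\<exists>c ps. c \<le> b \<and> \<pi> ! c \<le> \<pi> ! b \<and> set ps \<subseteq> R \<and> occurrence \<pi> \<mu> (ps @ [c])))"
proof (induction n)
  case 0
  show ?case
    using assms by (auto dest: length_occurrence)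
next
  case (Suc n)
  define traced where "traced R b \<longleftrightarrow>
    (\<exists>c ps. c \<le> b \<and> \<pi> ! c \<le> \<pi> ! b \<and> set ps \<subseteq> R \<and> occurrence \<pi> \<mu> (ps @ [c]))" for R b
  obtain R where R: "R \<subseteq> {..<n}" "\<And>ps. occurrence \<pi> \<mu> ps \<Longrightarrow> \<not> set ps \<subseteq> R"
      "\<And>r b. r \<in> R \<Longrightarrow> b < r \<Longrightarrow> b \<notin> R \<Longrightarrow> \<not> \<pi> ! b < \<pi> ! r"
      "\<And>b. b < n \<Longrightarrow> b \<notin> R \<Longrightarrow> traced R b"
    using Suc.IH unfolding traced_def by metis
  have keep_R: ?case if "traced R n"
  proof -
    have "traced R b" if "b < Suc n" "b \<notin> R" for b
      using R(4)[of b] that \<open>traced R n\<close> by (cases "b = n") auto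
    then show ?thesis
      using R(1-3) unfolding traced_def by (intro exI[of _ R]) (auto simp: less_Suc_eq)
  qed
  consider (below) b where "b < n" "b \<notin> R" "\<pi> ! b < \<pi> ! n"
    | (completes) ps where "occurrence \<pi> \<mu> ps" "set ps \<subseteq> insert n R"
    | (red) "\<And>b. b < n \<Longrightarrow> b \<notin> R \<Longrightarrow> \<not> \<pi> ! b < \<pi> ! n"
        "\<And>ps. occurrence \<pi> \<mu> ps \<Longrightarrow> \<not> set ps \<subseteq> insert n R"
    by blast
  then show ?case
  proof cases
    case below
    then have "traced R n"
      using R(4)[of b] unfolding traced_def by (meson less_imp_le order_trans)
    then show ?thesis
      by (rule keep_R)
  next
    case completes
    have "ps \<noteq> []"
      using length_occurrence[OF completes(1)] assms by auto
    then obtain qs c where ps: "ps = qs @ [c]"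
      by (cases ps rule: rev_cases) auto
    have qs_less: "q < c" if "q \<in> set qs" for q
      using completes(1) that by (auto simp: occurrence_def ps sorted_wrt_append)
    \<comment> \<open>\<open>n\<close> exceeds all of \<open>R\<close>, so it can only be the last position of the completed occurrence.\<close>
    have "n \<in> set ps"
      using R(2)[OF completes(1)] completes(2) by blast
    moreover have "c \<le> n"
      using completes(2) R(1) by (auto simp: ps)
    ultimately have "c = n"
      using qs_less[of n] by (auto simp: ps)
    moreover have "set qs \<subseteq> R"
      using qs_less completes(2) \<open>c = n\<close> by (auto simp: ps)
    ultimately have "traced R n"
      using completes(1) unfolding traced_def ps by blast
    then show ?thesis
      by (rule keep_R)
  next
    case red
    have "traced (insert n R) b" if "b < Suc n" "b \<notin> insert n R" for b
      using R(4)[of b] that unfolding traced_def by (auto simp: less_Suc_eq)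
    moreover have "\<not> \<pi> ! b < \<pi> ! r" if "r \<in> insert n R" "b < r" "b \<notin> insert n R" for r b
      using R(3) red(1) that by auto
    ultimately show ?thesis
      using R(1) red(2) unfolding traced_def by (intro exI[of _ "insert n R"]) (auto simp: less_Suc_eq)
  qed
qed

text \<open>
  The blue copy of \<open>(\<tau> \<ominus> 1) \<oplus> \<rho>\<close> always supplies \<open>\<rho>\<close>.  The remaining part \<open>\<sigma> \<oplus> (\<tau> \<ominus> 1)\<close> is either
  the nearly red copy attached to the \<open>1\<close> of the blue copy, or the \<open>\<sigma>\<close> of that nearly red copy
  together with the blue \<open>\<tau> \<ominus> 1\<close>, depending on whether the red \<open>\<tau>\<close> stays below \<open>\<rho>\<close>.
\<close>

lemma occurrence_from_colouring:
  assumes perms: "is_perm \<sigma>" "is_perm \<tau>" "is_perm \<rho>"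
    and red: "\<forall>r\<in>R. \<forall>b<r. b \<notin> R \<longrightarrow> \<not> \<pi> ! b < \<pi> ! r"
    and blue: "\<forall>b<length \<pi>. b \<notin> R \<longrightarrow> (\<exists>c ps. c \<le> b \<and> \<pi> ! c \<le> \<pi> ! b \<and> set ps \<subseteq> R \<and>
      occurrence \<pi> (\<sigma> \<oplus> (\<tau> \<ominus> [1])) (ps @ [c]))"
    and qs: "occurrence \<pi> ((\<tau> \<ominus> [1]) \<oplus> \<rho>) qs" "set qs \<inter> R = {}"
  obtains (found) ps where "occurrence \<pi> (\<sigma> \<oplus> (\<tau> \<ominus> [1]) \<oplus> \<rho>) ps"
proof -
  have perm_\<tau>1: "is_perm (\<tau> \<ominus> [1])"
    using is_perm_skew_sum[OF perms(2) is_perm_singleton] .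
  obtain us rs where us: "occurrence \<pi> (\<tau> \<ominus> [1]) us" and rs: "occurrence \<pi> \<rho> rs"
    and qs_eq: "qs = us @ rs" and us_rs: "\<And>u r. u \<in> set us \<Longrightarrow> r \<in> set rs \<Longrightarrow> u < r \<and> \<pi> ! u < \<pi> ! r"
    using occurrence_direct_sumE[OF qs(1) perm_\<tau>1 perms(3)] by metis
  obtain ts' b where us_eq: "us = ts' @ [b]" and ts'_b: "\<And>t. t \<in> set ts' \<Longrightarrow> t < b \<and> \<pi> ! b < \<pi> ! t"
    using occurrence_skew_sum_oneE[OF us perms(2)] by metis
  have "b < length \<pi>" "b \<notin> R"
    using us qs(2) by (auto simp: occurrence_def us_eq qs_eq)
  then obtain c ps where c: "c \<le> b" "\<pi> ! c \<le> \<pi> ! b" and ps: "set ps \<subseteq> R"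
    and ps_c: "occurrence \<pi> (\<sigma> \<oplus> (\<tau> \<ominus> [1])) (ps @ [c])"
    using blue by blast
  obtain ss vs where ss: "occurrence \<pi> \<sigma> ss" and vs: "occurrence \<pi> (\<tau> \<ominus> [1]) vs"
    and ps_c_eq: "ps @ [c] = ss @ vs"
    and ss_vs: "\<And>s v. s \<in> set ss \<Longrightarrow> v \<in> set vs \<Longrightarrow> s < v \<and> \<pi> ! s < \<pi> ! v"
    using occurrence_direct_sumE[OF ps_c perms(1) perm_\<tau>1] by metis
  obtain ts where vs_eq: "vs = ts @ [c]" and ts_c: "\<And>t. t \<in> set ts \<Longrightarrow> t < c \<and> \<pi> ! c < \<pi> ! t"
    using occurrence_skew_sum_oneE[OF vs perms(2)] ps_c_eq by (metis append_assoc append1_eq_conv)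
  have ts: "set ts \<subseteq> R"
    using ps ps_c_eq by (auto simp: vs_eq simp flip: append_assoc)
  have b_us: "b \<in> set us" and c_vs: "c \<in> set vs"
    by (simp_all add: us_eq vs_eq)
  \<comment> \<open>It suffices to find a copy of \<open>\<tau> \<ominus> 1\<close> between \<open>ss\<close> and \<open>rs\<close>.\<close>
  have assemble: thesis if ws: "occurrence \<pi> (\<tau> \<ominus> [1]) ws"
    and ss_ws: "\<And>s w. s \<in> set ss \<Longrightarrow> w \<in> set ws \<Longrightarrow> s < w \<and> \<pi> ! s < \<pi> ! w"
    and ws_rs: "\<And>w r. w \<in> set ws \<Longrightarrow> r \<in> set rs \<Longrightarrow> w < r \<and> \<pi> ! w < \<pi> ! r" for ws
  proof -
    have "s < r \<and> \<pi> ! s < \<pi> ! r" if "s \<in> set ss" "r \<in> set rs" for s r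
      using ss_vs[OF that(1) c_vs] us_rs[OF b_us that(2)] c by linarith
    moreover have "occurrence \<pi> ((\<tau> \<ominus> [1]) \<oplus> \<rho>) (ws @ rs)"
      using ws rs ws_rs perm_\<tau>1 perms(3)
      by (simp add: occurrence_direct_sum_append_iff length_occurrence)
    ultimately have "occurrence \<pi> (\<sigma> \<oplus> (\<tau> \<ominus> [1]) \<oplus> \<rho>) (ss @ ws @ rs)"
      using ss ss_ws is_perm_direct_sum[OF perm_\<tau>1 perms(3)] perms(1)
      by (subst occurrence_direct_sum_append_iff) (auto dest: length_occurrence)
    then show thesis
      by (rule found)
  qed
  show thesis
  proof (cases "\<forall>t\<in>set ts. \<forall>r\<in>set rs. \<pi> ! t < \<pi> ! r")
    case True
    have "v < r \<and> \<pi> ! v < \<pi> ! r" if "v \<in> set vs" "r \<in> set rs" for v r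
    proof -
      have "v \<le> c"
        using that(1) ts_c by (auto simp: vs_eq less_imp_le)
      then show ?thesis
        using that True us_rs[OF b_us that(2)] c by (auto simp: vs_eq)
    qed
    then show thesis
      using assemble[OF vs ss_vs] by blast
  next
    case False
    then obtain t r where t: "t \<in> set ts" and r: "r \<in> set rs" "\<pi> ! r \<le> \<pi> ! t"
      by (auto simp: not_less)
    \<comment> \<open>Otherwise the red \<open>t\<close> would lie above and to the right of the blue \<open>u\<close>.\<close>
    have t_left: "t < u" if "u \<in> set us" for u
    proof (rule ccontr)
      assume "\<not> t < u"
      moreover have "u \<notin> R" "t \<in> R"
        using that qs(2) t ts by (auto simp: qs_eq)
      moreover have "\<pi> ! u < \<pi> ! t"
        using us_rs[OF that r(1)] r(2) by simp
      ultimately show False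
        using red by (metis linorder_neqE_nat)
    qed
    have "s < u \<and> \<pi> ! s < \<pi> ! u" if "s \<in> set ss" "u \<in> set us" for s u
    proof -
      have "\<pi> ! b \<le> \<pi> ! u"
        using that(2) ts'_b by (auto simp: us_eq less_imp_le)
      moreover have "s < t" "\<pi> ! s < \<pi> ! c"
        using ss_vs[OF that(1)] t by (auto simp: vs_eq)
      ultimately show ?thesis
        using t_left[OF that(2)] c by linarith
    qed
    then show thesis
      using assemble[OF us _ us_rs] by blast
  qed
qed

theorem lemma3:
  fixes \<sigma> \<tau> \<rho> \<pi> :: "nat list"
  assumes "is_perm \<sigma>" and "is_perm \<tau>" and "is_perm \<rho>"
    and "is_perm \<pi>" and "avoids \<pi> (\<sigma> \<oplus> (\<tau> \<ominus> [1]) \<oplus> \<rho>)"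
  shows "\<exists>\<alpha> \<beta>. is_perm \<alpha> \<and> is_perm \<beta> \<and> is_merge \<pi> \<alpha> \<beta> \<and>
           avoids \<alpha> (\<sigma> \<oplus> (\<tau> \<ominus> [1])) \<and> avoids \<beta> ((\<tau> \<ominus> [1]) \<oplus> \<rho>)"
proof -
  have "\<sigma> \<oplus> (\<tau> \<ominus> [1]) \<noteq> []"
    by (simp add: direct_sum_def skew_sum_def)
  then obtain R where R: "R \<subseteq> {..<length \<pi>}"
    and red_avoids: "\<forall>ps. occurrence \<pi> (\<sigma> \<oplus> (\<tau> \<ominus> [1])) ps \<longrightarrow> \<not> set ps \<subseteq> R"
    and red: "\<forall>r\<in>R. \<forall>b<r. b \<notin> R \<longrightarrow> \<not> \<pi> ! b < \<pi> ! r"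
    and blue: "\<forall>b<length \<pi>. b \<notin> R \<longrightarrow> (\<exists>c ps. c \<le> b \<and> \<pi> ! c \<le> \<pi> ! b \<and> set ps \<subseteq> R \<and>
      occurrence \<pi> (\<sigma> \<oplus> (\<tau> \<ominus> [1])) (ps @ [c]))"
    using greedy_colouring[of "\<sigma> \<oplus> (\<tau> \<ominus> [1])" "length \<pi>" \<pi>] by blast
  define B where "B = {..<length \<pi>} - R"
  have "is_merge \<pi> (pattern \<pi> R) (pattern \<pi> B)"
    unfolding is_merge_def using R by (intro exI[of _ R] exI[of _ B]) (auto simp: B_def)
  moreover have "is_perm (pattern \<pi> R)" "is_perm (pattern \<pi> B)"
    using pattern_eq_iff[OF assms(4)] by blast+
  moreover have "avoids (pattern \<pi> R) (\<sigma> \<oplus> (\<tau> \<ominus> [1]))"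
    using occurrence_if_pattern_contains[OF assms(4)] red_avoids by metis
  moreover have "avoids (pattern \<pi> B) ((\<tau> \<ominus> [1]) \<oplus> \<rho>)"
  proof
    assume "contains (pattern \<pi> B) ((\<tau> \<ominus> [1]) \<oplus> \<rho>)"
    then obtain qs where qs: "occurrence \<pi> ((\<tau> \<ominus> [1]) \<oplus> \<rho>) qs" "set qs \<subseteq> B"
      using occurrence_if_pattern_contains[OF assms(4)] by metis
    then have "set qs \<inter> R = {}"
      by (auto simp: B_def)
    then obtain ps where "occurrence \<pi> (\<sigma> \<oplus> (\<tau> \<ominus> [1]) \<oplus> \<rho>) ps"
      using occurrence_from_colouring[OF assms(1-3) red blue qs(1)] by blast
    moreover have "is_perm (\<sigma> \<oplus> (\<tau> \<ominus> [1]) \<oplus> \<rho>)"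
      by (intro is_perm_direct_sum is_perm_skew_sum is_perm_singleton assms(1-3))
    ultimately show False
      using contains_if_occurrence assms(4,5) by blast
  qed
  ultimately show ?thesis
    by blast
qed

end
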